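(* Let $\Xi=\mathbb{R}^k$ be equipped with the Euclidean metric $d(\boldsymbol{\xi},\boldsymbol{\xi}')=\|\boldsymbol{\xi}-\boldsymbol{\xi}'\|$, and let $\mathcal{M}_N^r$ be the Wasserstein ambiguity set with $p=1$, radius $r$, and center the empirical distribution of samples $\boldsymbol{\xi}_1,\dots,\boldsymbol{\xi}_N\in\Xi$. For $l\in[M]$ let $$G_l(\mathbf{x},\underline{\mathbf{u}},\boldsymbol{\xi})=\underline{\mathbf{u}}^\top\mathbf{q}_l(\mathbf{x})+\underline{\mathbf{u}}^\top\mathbf{R}_l(\mathbf{x})\boldsymbol{\xi}+\alpha_l(J_l(\mathbf{x})).$$ Then, for each fixed $\mathbf{x}\in\mathcal{X}$, the optimization problem $$\min_{\underline{\mathbf{u}}\in\underline{\mathcal{U}}}\ \|\underline{\mathbf{u}}-\underline{\mathbf{k}}(\mathbf{x})\|^2\quad\text{s.t.}\quad \sup_{\mathbb{P}\in\mathcal{M}_N^r}\ \inf_{t_l\in\mathbb{R}}\Big[\epsilon^{-1}\mathbb{E}_{\mathbb{P}}\big[(G_l(\mathbf{x},\underline{\mathbf{u}},\boldsymbol{\xi})+t_l)_+\big]-t_l\Big]\le 0\quad\forall l\in[M]$$ is equivalent to the second-order cone program $$\min_{\underline{\mathbf{u}}\in\underline{\mathcal{U}},\ y\in\mathbb{R},\ t_l\in\mathbb{R},\ s_l(i)\in\mathbb{R}}\ y$$ subject to $$r\,\|\underline{\mathbf{u}}^\top\mathbf{R}_l(\mathbf{x})\|+\frac1N\sum_{i=1}^N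 s_l(i)-t_l\,\epsilon\le 0\quad\forall l\in[M],$$ $$s_l(i)\ge G_l(\mathbf{x},\underline{\mathbf{u}},\boldsymbol{\xi}_i)+t_l,\qquad s_l(i)\ge 0\quad\forall i\in[N],\ \forall l\in[M],$$ $$y+1\ge\sqrt{\|2(\underline{\mathbf{u}}-\underline{\mathbf{k}}(\mathbf{x}))\|^2+(y-1)^2}.$$
   Context: Notation: $[N]=\{1,\dots,N\}$; $(a)_+=\max(a,0)$ for real $a$; $\|\cdot\|$ is the Euclidean norm. $N,M,m,n,k$ are positive integers, $\mathcal{X}\subseteq\mathbb{R}^n$, and $\epsilon\in(0,1)$ is a risk tolerance. The (augmented) control input set is $\underline{\mathcal{U}}=\{1\}\times\mathbb{R}^m\subset\mathbb{R}^{m+1}$, and $\underline{\mathbf{k}}:\mathcal{X}\to\underline{\mathcal{U}}$ is a given baseline controller. For each $l\in[M]$, $\mathbf{q}_l(\mathbf{x})\in\mathbb{R}^{m+1}$, $\mathbf{R}_l(\mathbf{x})\in\mathbb{R}^{(m+1)\times k}$ and $\alpha_l(J_l(\mathbf{x}))\in\mathbb{R}$ are given deterministic functions of $\mathbf{x}$. Wasserstein ambiguity set: let $\Xi\subseteq\mathbb{R}^k$ carry a metric $d$, and let $\mathcal{P}_p(\Xi)$ be the Borel probability measures on $\Xi$ with finite $p$-th moment. The $p$-Wasserstein distance is $W_p(\mu,\nu)=\big(\inf_{\gamma\in\mathbb{Q}(\mu,\nu)}\int_{\Xi\times\Xi}d(x,y)^p\,\mathrm{d}\gamma(x,y)\big)^{1/p}$,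 where $\mathbb{Q}(\mu,\nu)$ is the set of measures on $\Xi\times\Xi$ with marginals $\mu$ and $\nu$. Given samples $\boldsymbol{\xi}_1,\dots,\boldsymbol{\xi}_N\in\Xi$, the empirical distribution is $\hat{\mathbb{P}}_N=\frac1N\sum_{i=1}^N\delta_{\boldsymbol{\xi}_i}$, and the ambiguity set of radius $r\ge0$ is $\mathcal{M}_N^r=\{\mu\in\mathcal{P}_p(\Xi): W_p(\mu,\hat{\mathbb{P}}_N)\le r\}$. $\mathbb{E}_{\mathbb{P}}$ is the expectation over $\boldsymbol{\xi}\sim\mathbb{P}$. Equivalence: two programs sharing the decision variable $\underline{\mathbf{u}}$ (one possibly having additional auxiliary variables) are equivalent if $\underline{\mathbf{u}}$ is feasible (respectively optimal) for the first if and only if it can be completed by auxiliary variables to a feasible (respectively optimal) point of the second, and the optimal values coincide. *)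

theory Defs
  imports "HOL-Probability.Probability"
begin

section \<open>Wasserstein ambiguity sets\<close>

text \<open>
  The ground space \<open>\<Xi>\<close> is a whole type, and its metric is the \<^const>\<open>dist\<close> of that type.
  Second countability makes \<^const>\<open>dist\<close> measurable for the product sigma-algebra.
\<close>

definition wass_space :: "real \<Rightarrow> 'a :: {metric_space, second_countable_topology} measure set"
  where "wass_space p = {\<mu>. prob_space \<mu> \<and> sets \<mu> = sets borel \<and>
     (\<exists>x0. (\<integral>\<^sup>+ x. ennreal (dist x x0 powr p) \<partial>\<mu>) < \<infinity>)}"

definition couplings ::
    "'a measure \<Rightarrow> 'a measure \<Rightarrow> ('a :: {metric_space, second_countable_topology} \<times> 'a) measure set"
  where "couplings \<mu> \<nu> = {\<gamma>. sets \<gamma> = sets (borel \<Otimes>\<^sub>M borel) \<and>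
     distr \<gamma> borel fst = \<mu> \<and> distr \<gamma> borel snd = \<nu>}"

definition transport_cost ::
    "real \<Rightarrow> 'a :: {metric_space, second_countable_topology} measure \<Rightarrow> 'a measure \<Rightarrow> ennreal"
  where "transport_cost p \<mu> \<nu> =
     (INF \<gamma> \<in> couplings \<mu> \<nu>. \<integral>\<^sup>+ z. ennreal (dist (fst z) (snd z) powr p) \<partial>\<gamma>)"

text \<open>The case distinction is the \<open>p\<close>-th root extended to \<^const>\<open>ennreal\<close>-valued costs.\<close>

definition wasserstein ::
    "real \<Rightarrow> 'a :: {metric_space, second_countable_topology} measure \<Rightarrow> 'a measure \<Rightarrow> ennreal"
  where "wasserstein p \<mu> \<nu> =
     (if transport_cost p \<mu> \<nu> = \<infinity> then \<infinity>
      else ennreal (enn2real (transport_cost p \<mu> \<nu>) powr (1 / p)))"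

definition empirical :: "nat \<Rightarrow> (nat \<Rightarrow> 'a :: topological_space) \<Rightarrow> 'a measure"
  where "empirical N \<xi> = measure_of UNIV (sets borel)
     (\<lambda>A. ennreal (1 / real N) * (\<Sum>i=1..N. emeasure (return borel (\<xi> i)) A))"

text \<open>\<^const>\<open>measure_of\<close> collapses to the zero measure unless its argument is countably
  additive; the following facts exclude this.\<close>

lemma sets_empirical [simp]: "sets (empirical N \<xi>) = sets borel"
  unfolding empirical_def using sets.sigma_sets_eq[of "borel :: 'a measure"]
  by (metis sets_measure_of sets.space_closed space_borel)

lemma emeasure_empirical:
  assumes "A \<in> sets borel"
  shows "emeasure (empirical N \<xi>) A =
    ennreal (1 / real N) * (\<Sum>i=1..N. emeasure (return borel (\<xi> i)) A)"
proof (rule emeasure_measure_of[OF empirical_def])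
  show "sets borel \<subseteq> Pow (UNIV :: 'a set)" by simp
  show "A \<in> sets (empirical N \<xi>)" using assms by simp
  show "positive (sets (empirical N \<xi>))
     (\<lambda>A. ennreal (1 / real N) * (\<Sum>i=1..N. emeasure (return borel (\<xi> i)) A))"
    by (simp add: positive_def)
  show "countably_additive (sets (empirical N \<xi>))
     (\<lambda>A. ennreal (1 / real N) * (\<Sum>i=1..N. emeasure (return borel (\<xi> i)) A))"
  proof (rule countably_additiveI)
    fix B :: "nat \<Rightarrow> 'a set"
    assume B: "range B \<subseteq> sets (empirical N \<xi>)" "disjoint_family B"
    have "(\<Sum>i=1..N. emeasure (return borel (\<xi> i)) (\<Union>j. B j)) =
        (\<Sum>i=1..N. \<Sum>j. emeasure (return borel (\<xi> i)) (B j))"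
      using B by (intro sum.cong refl suminf_emeasure[symmetric]) auto
    also have "\<dots> = (\<Sum>j. \<Sum>i=1..N. emeasure (return borel (\<xi> i)) (B j))"
      by (rule suminf_sum[symmetric]) simp
    finally show "(\<Sum>j. ennreal (1 / real N) * (\<Sum>i=1..N. emeasure (return borel (\<xi> i)) (B j))) =
        ennreal (1 / real N) * (\<Sum>i=1..N. emeasure (return borel (\<xi> i)) (\<Union>j. B j))"
      by (simp add: ennreal_suminf_cmult)
  qed
qed

definition ambiguity_set :: "real \<Rightarrow> real \<Rightarrow> nat \<Rightarrow>
    (nat \<Rightarrow> 'a :: {metric_space, second_countable_topology}) \<Rightarrow> 'a measure set"
  where "ambiguity_set p r N \<xi> =
     {\<mu> \<in> wass_space p. wasserstein p \<mu> (empirical N \<xi>) \<le> ennreal r}"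


section \<open>Augmented control inputs\<close>

text \<open>Vectors in \<open>\<real>\<^bsup>m+1\<^esup>\<close> are indexed by \<^typ>\<open>'m option\<close>; \<^const>\<open>None\<close> is the extra first
  coordinate.\<close>

definition aug_inputs :: "(real ^ ('m :: finite option)) set"
  where "aug_inputs = {u. u $ None = 1}"


section \<open>Equivalence of minimization programs\<close>

text \<open>A program is a feasible set together with an objective.  Its value is extended real, so
  that an infeasible program has value \<open>\<infinity>\<close>.\<close>

definition is_optimal :: "'a set \<Rightarrow> ('a \<Rightarrow> real) \<Rightarrow> 'a \<Rightarrow> bool"
  where "is_optimal F f z \<longleftrightarrow> z \<in> F \<and> (\<forall>w\<in>F. f z \<le> f w)"

definition optimal_value :: "'a set \<Rightarrow> ('a \<Rightarrow> real) \<Rightarrow> ereal"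
  where "optimal_value F f = (INF z\<in>F. ereal (f z))"

definition equivalent_programs ::
    "'u set \<Rightarrow> ('u \<Rightarrow> real) \<Rightarrow> ('u \<times> 'v) set \<Rightarrow> ('u \<times> 'v \<Rightarrow> real) \<Rightarrow> bool"
  where "equivalent_programs F f F' f' \<longleftrightarrow>
     (\<forall>u. u \<in> F \<longleftrightarrow> (\<exists>v. (u, v) \<in> F')) \<and>
     (\<forall>u. is_optimal F f u \<longleftrightarrow> (\<exists>v. is_optimal F' f' (u, v))) \<and>
     optimal_value F f = optimal_value F' f'"

end

theory Submission
  imports Defs
begin

text \<open>
  For fixed \<open>u\<close> and \<open>l\<close> the function \<open>G l x u\<close> is affine in the uncertainty,
  \<open>z \<mapsto> a \<bullet> z + b\<close> with \<open>a = u v* R l x\<close>.  The heart of the matter is that the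
  distributionally robust constraint on it says exactly that
  \<open>r * norm a + 1/N * (\<Sum>i. max (a \<bullet> \<xi> i + b + t) 0) - t * \<epsilon> \<le> 0\<close> for some \<open>t\<close>
  (\<open>worst_case_cvar_le_0_iff\<close>).  The auxiliary variables \<open>s\<close> then merely linearize the
  positive parts.

  One direction is weak transport duality: \<open>z \<mapsto> max (a \<bullet> z + b) 0\<close> is \<open>norm a\<close>-Lipschitz,
  so moving from the empirical distribution to any member of the ambiguity set raises its
  expectation by at most \<open>r * norm a\<close> (\<open>worst_case_expectation_le\<close>).  The same \<open>t\<close> therefore
  works for all members.

  The other direction would usually be a minimax theorem, exchanging the supremum over
  distributions with the infimum over \<open>t\<close>.  Here a single worst distribution can be
  written down instead.  The quantity \<open>inf\<^sub>t [E (h + t)\<^sub>+ / \<epsilon> - t]\<close> is the mean of \<open>h\<close> over the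
  worst \<open>\<epsilon>\<close>-fraction of its distribution, and for the empirical distribution the infimum is
  attained at minus the quantile that bounds this tail (\<open>cvar_eq_tail_mean\<close>).  Moving exactly
  the tail, of mass \<open>\<epsilon>\<close>, by the distance \<open>r / \<epsilon>\<close> in the direction of \<open>a\<close> costs at most \<open>r\<close> and raises
  the tail mean by \<open>r * norm a / \<epsilon>\<close>, which is the most that the first direction allows
  (\<open>shifted_tail_distribution\<close>).

  Finally the cone constraint on \<open>y\<close> is the epigraph constraint \<open>(norm (u - k x))\<^sup>2 \<le> y\<close>
  (\<open>square_le_iff_cone\<close>), and passing to the epigraph with additional feasibility witnesses
  preserves minimizers and values (\<open>equivalent_programs_epigraph\<close>).
\<close>

section \<open>The upper tail of a finite sample\<close>

text \<open>
  Mass \<open>e\<close> is filled greedily from the largest values of \<open>h\<close> downwards; the atoms at the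
  threshold \<open>c\<close>, the quantile, may be used partially.  The induction adds the largest
  value last, so that either it alone absorbs all of \<open>e\<close> or it is filled completely and
  the rest is left to the smaller values.
\<close>

lemma upper_tail_weights:
  fixes h p :: "'i \<Rightarrow> real"
  assumes "finite I" "\<And>i. i \<in> I \<Longrightarrow> 0 \<le> p i" "0 \<le> e" "e \<le> sum p I"
  obtains c w where "\<And>i. i \<in> I \<Longrightarrow> 0 \<le> w i" "\<And>i. i \<in> I \<Longrightarrow> w i \<le> p i" "sum w I = e"
    "\<And>i. i \<in> I \<Longrightarrow> c < h i \<Longrightarrow> w i = p i" "\<And>i. i \<in> I \<Longrightarrow> h i < c \<Longrightarrow> w i = 0"
proof -
  have "\<exists>c w. (\<forall>i\<in>I. 0 \<le> w i \<and> w i \<le> p i) \<and> sum w I = e \<and>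
      (\<forall>i\<in>I. (c < h i \<longrightarrow> w i = p i) \<and> (h i < c \<longrightarrow> w i = 0))"
    using assms
  proof (induction arbitrary: e rule: finite_ranking_induct[where f = h])
    case empty
    then show ?case by auto
  next
    case (insert j S)
    show ?case
    proof (cases "j \<in> S")
      case True
      then show ?thesis using insert by (simp add: insert_absorb)
    next
      case j: False
      show ?thesis
      proof (cases "e \<le> p j")
        case True
        let ?w = "\<lambda>i. if i = j then e else 0"
        have "\<forall>i\<in>insert j S. 0 \<le> ?w i \<and> ?w i \<le> p i" using insert.prems True by auto
        moreover have "sum ?w (insert j S) = e" using insert.hyps(1) by simp
        moreover have "\<forall>i\<in>insert j S. (h j < h i \<longrightarrow> ?w i = p i) \<and> (h i < h j \<longrightarrow> ?w i = 0)"
          using insert.hyps(2) by fastforce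
        ultimately show ?thesis by (intro exI[of _ "h j"] exI[of _ ?w] conjI)
      next
        case False
        have "0 \<le> e - p j" "e - p j \<le> sum p S" using insert.prems insert.hyps j False by auto
        then obtain c w where w: "\<forall>i\<in>S. 0 \<le> w i \<and> w i \<le> p i" "sum w S = e - p j"
            "\<forall>i\<in>S. (c < h i \<longrightarrow> w i = p i) \<and> (h i < c \<longrightarrow> w i = 0)"
          using insert.IH[of "e - p j"] insert.prems by auto
        \<comment> \<open>A threshold above the largest value would leave no mass on \<open>S\<close>.\<close>
        have "c \<le> h j"
        proof (rule ccontr)
          assume "\<not> c \<le> h j"
          then have "\<forall>i\<in>S. w i = 0" using w(3) insert.hyps(2) by force
          then have "sum w S = 0" by simp
          with w(2) False show False by simp
        qed
        let ?w = "w(j := p j)"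
        have "sum ?w S = sum w S" using j by (intro sum.cong) auto
        then have "sum ?w (insert j S) = e" using w(2) insert.hyps(1) j by simp
        moreover have "\<forall>i\<in>insert j S. 0 \<le> ?w i \<and> ?w i \<le> p i"
          using w(1) insert.prems(1) by simp
        moreover have "\<forall>i\<in>insert j S. (c < h i \<longrightarrow> ?w i = p i) \<and> (h i < c \<longrightarrow> ?w i = 0)"
          using w(3) \<open>c \<le> h j\<close> by simp
        ultimately show ?thesis by (intro exI[of _ c] exI[of _ ?w] conjI)
      qed
    qed
  qed
  then obtain c w where "\<forall>i\<in>I. 0 \<le> w i \<and> w i \<le> p i" "sum w I = e"
      "\<forall>i\<in>I. (c < h i \<longrightarrow> w i = p i) \<and> (h i < c \<longrightarrow> w i = 0)"
    by (elim exE conjE)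
  then show ?thesis by (intro that[of w c]) simp_all
qed

text \<open>
  At minus the quantile \<open>c\<close>, each positive part weighted by \<open>1/N\<close> agrees with \<open>w i * (h i - c)\<close>:
  above the quantile the weight is full, below it both sides vanish, and at it the factor is zero.
\<close>

lemma cvar_eq_tail_mean:
  fixes h :: "nat \<Rightarrow> real"
  assumes "N \<ge> 1" "0 \<le> \<epsilon>" "\<epsilon> \<le> 1"
  obtains t w where "\<And>i. i \<in> {1..N} \<Longrightarrow> 0 \<le> w i" "\<And>i. i \<in> {1..N} \<Longrightarrow> w i \<le> 1 / real N"
    "(\<Sum>i=1..N. w i) = \<epsilon>"
    "1 / real N * (\<Sum>i=1..N. max (h i + t) 0) - t * \<epsilon> = (\<Sum>i=1..N. w i * h i)"
proof -
  obtain c w where w: "\<And>i. i \<in> {1..N} \<Longrightarrow> 0 \<le> w i" "\<And>i. i \<in> {1..N} \<Longrightarrow> w i \<le> 1 / real N"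
    "sum w {1..N} = \<epsilon>"
    "\<And>i. i \<in> {1..N} \<Longrightarrow> c < h i \<Longrightarrow> w i = 1 / real N" "\<And>i. i \<in> {1..N} \<Longrightarrow> h i < c \<Longrightarrow> w i = 0"
    by (rule upper_tail_weights[of "{1..N}" "\<lambda>_. 1 / real N" \<epsilon> h]) (use assms in auto)
  have "1 / real N * max (h i - c) 0 = w i * (h i - c)" if "i \<in> {1..N}" for i
    using w(4,5)[OF that] by (cases "h i" c rule: linorder_cases) auto
  then have "1 / real N * (\<Sum>i=1..N. max (h i - c) 0) = (\<Sum>i=1..N. w i * (h i - c))"
    unfolding sum_distrib_left by (intro sum.cong) auto
  also have "\<dots> = (\<Sum>i=1..N. w i * h i) - c * \<epsilon>"
    by (simp add: right_diff_distrib sum_subtractf w(3)[symmetric] sum_distrib_left mult.commute)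
  finally show ?thesis using that[of w "- c"] w by simp
qed

section \<open>Transport and expectations\<close>

text \<open>
  The easy half of Kantorovich-Rubinstein duality.  The transport cost is an infimum of
  which nothing says that it is attained, so couplings within \<open>e / (L + 1)\<close> of it are used;
  the \<open>1\<close> covers the case \<open>L = 0\<close>.
\<close>

lemma lipschitz_transport_bound:
  fixes \<phi> :: "'a :: {metric_space, second_countable_topology} \<Rightarrow> real"
  assumes lip: "L-lipschitz_on UNIV \<phi>" and nn: "\<And>z. 0 \<le> \<phi> z"
    and cost: "transport_cost 1 \<mu> \<nu> \<le> ennreal r" and r: "0 \<le> r"
  shows "(\<integral>\<^sup>+z. \<phi> z \<partial>\<mu>) \<le> (\<integral>\<^sup>+z. \<phi> z \<partial>\<nu>) + ennreal (L * r)"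
proof (rule ennreal_le_epsilon)
  have L: "0 \<le> L" using lip by (rule lipschitz_on_nonneg)
  fix e :: real assume e: "0 < e"
  have [measurable]: "\<phi> \<in> borel_measurable borel"
    by (intro borel_measurable_continuous_onI lipschitz_on_continuous_on[OF lip])
  let ?d = "e / (L + 1)"
  have d: "0 < ?d" using e L by simp
  have "transport_cost 1 \<mu> \<nu> < ennreal (r + ?d)"
    using cost r d by (elim order.strict_trans1) (simp add: ennreal_less_iff)
  then obtain \<gamma> where \<gamma>: "\<gamma> \<in> couplings \<mu> \<nu>"
      "(\<integral>\<^sup>+ z. ennreal (dist (fst z) (snd z) powr 1) \<partial>\<gamma>) < ennreal (r + ?d)"
    unfolding transport_cost_def INF_less_iff by blast
  have [measurable_cong]: "sets \<gamma> = sets (borel \<Otimes>\<^sub>M borel)"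
    and \<mu>: "\<mu> = distr \<gamma> borel fst" and \<nu>: "\<nu> = distr \<gamma> borel snd"
    using \<gamma>(1) by (auto simp: couplings_def)
  have "(\<integral>\<^sup>+z. \<phi> z \<partial>\<mu>) = (\<integral>\<^sup>+z. \<phi> (fst z) \<partial>\<gamma>)"
    unfolding \<mu> by (rule nn_integral_distr) measurable
  also have "\<dots> \<le> (\<integral>\<^sup>+z. ennreal (\<phi> (snd z)) +
      ennreal L * ennreal (dist (fst z) (snd z) powr 1) \<partial>\<gamma>)"
  proof (rule nn_integral_mono)
    fix z :: "'a \<times> 'a"
    have "\<phi> (fst z) \<le> \<phi> (snd z) + L * dist (fst z) (snd z)"
      using lipschitz_onD[OF lip, of "fst z" "snd z"] by (auto simp: dist_real_def)
    then show "ennreal (\<phi> (fst z)) \<le> ennreal (\<phi> (snd z)) +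
        ennreal L * ennreal (dist (fst z) (snd z) powr 1)"
      using L nn by (simp flip: ennreal_mult ennreal_plus)
  qed
  also have "\<dots> = (\<integral>\<^sup>+z. \<phi> (snd z) \<partial>\<gamma>) +
      ennreal L * (\<integral>\<^sup>+z. ennreal (dist (fst z) (snd z) powr 1) \<partial>\<gamma>)"
    by (subst nn_integral_add; (subst nn_integral_cmult)?; measurable)
  also have "(\<integral>\<^sup>+z. \<phi> (snd z) \<partial>\<gamma>) = (\<integral>\<^sup>+z. \<phi> z \<partial>\<nu>)"
    unfolding \<nu> by (rule nn_integral_distr[symmetric]) measurable
  also have "ennreal L * (\<integral>\<^sup>+z. ennreal (dist (fst z) (snd z) powr 1) \<partial>\<gamma>)
      \<le> ennreal L * ennreal (r + ?d)"
    using \<gamma>(2) by (intro mult_left_mono) auto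
  also have "\<dots> \<le> ennreal (L * r) + ennreal e"
    using L r e by (simp flip: ennreal_mult ennreal_plus add: ennreal_leI field_simps)
  finally show "(\<integral>\<^sup>+z. \<phi> z \<partial>\<mu>) \<le> (\<integral>\<^sup>+z. \<phi> z \<partial>\<nu>) + ennreal (L * r) + ennreal e"
    by (simp add: add.assoc add_mono)
qed

lemma wasserstein_1_le_iff:
  assumes "0 \<le> r"
  shows "wasserstein 1 \<mu> \<nu> \<le> ennreal r \<longleftrightarrow> transport_cost 1 \<mu> \<nu> \<le> ennreal r"
  by (cases "transport_cost 1 \<mu> \<nu>") (auto simp: wasserstein_def top_unique)

text \<open>
  A finite transport plan is encoded by its moves: move \<open>j\<close> carries the mass \<open>c j\<close> between
  \<open>a j\<close> and \<open>b j\<close>, and the two distributions are the images of one measure on the moves.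
\<close>

lemma transport_cost_point_measure:
  fixes a b :: "'j \<Rightarrow> 'a :: {metric_space, second_countable_topology}"
  assumes "finite S" "\<And>j. j \<in> S \<Longrightarrow> 0 \<le> c j"
  shows "transport_cost 1 (distr (point_measure S (\<lambda>j. ennreal (c j))) borel a)
      (distr (point_measure S (\<lambda>j. ennreal (c j))) borel b)
    \<le> ennreal (\<Sum>j\<in>S. c j * dist (a j) (b j))"
proof -
  let ?m = "point_measure S (\<lambda>j. ennreal (c j))"
  let ?g = "distr ?m (borel \<Otimes>\<^sub>M borel) (\<lambda>j. (a j, b j))"
  have meas: "(\<lambda>j. (a j, b j)) \<in> ?m \<rightarrow>\<^sub>M borel \<Otimes>\<^sub>M borel"
    by (simp add: space_pair_measure)
  have "?g \<in> couplings (distr ?m borel a) (distr ?m borel b)"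
    unfolding couplings_def using meas by (auto simp: distr_distr comp_def)
  then have "transport_cost 1 (distr ?m borel a) (distr ?m borel b)
      \<le> (\<integral>\<^sup>+ z. ennreal (dist (fst z) (snd z) powr 1) \<partial>?g)"
    unfolding transport_cost_def by (rule INF_lower)
  also have "\<dots> = (\<integral>\<^sup>+ j. ennreal (dist (a j) (b j)) \<partial>?m)"
    by (subst nn_integral_distr[OF meas]) (simp_all, measurable)
  also have "\<dots> = ennreal (\<Sum>j\<in>S. c j * dist (a j) (b j))"
    using assms by (simp add: nn_integral_point_measure_finite sum_nonneg
        flip: ennreal_mult sum_ennreal)
  finally show ?thesis .
qed

lemma point_measure_in_wass_space:
  fixes a :: "'j \<Rightarrow> 'a :: {metric_space, second_countable_topology}"
  assumes "finite S" "\<And>j. j \<in> S \<Longrightarrow> 0 \<le> c j" "sum c S = 1"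
  shows "distr (point_measure S (\<lambda>j. ennreal (c j))) borel a \<in> wass_space p"
proof -
  let ?m = "point_measure S (\<lambda>j. ennreal (c j))"
  have "prob_space (distr ?m borel a)"
    using assms by (intro prob_space.prob_space_distr prob_space_point_measure) auto
  moreover have "(\<integral>\<^sup>+ z. ennreal (dist z undefined powr p) \<partial>distr ?m borel a) < \<infinity>"
    using assms by (subst nn_integral_distr)
      (auto simp: nn_integral_point_measure_finite ennreal_mult_less_top)
  ultimately show ?thesis unfolding wass_space_def by auto
qed

text \<open>
  The atom at each sample may be split into several parts, as long as these add up to \<open>1/N\<close>;
  this allows a plan to treat parts of one atom differently.
\<close>

lemma empirical_eq_distr_point_measure:
  assumes S: "finite S" and c: "\<And>j. j \<in> S \<Longrightarrow> 0 \<le> c j" and f: "f ` S \<subseteq> {1..N}"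
    and fibre: "\<And>i. i \<in> {1..N} \<Longrightarrow> (\<Sum>j | j \<in> S \<and> f j = i. c j) = 1 / real N"
  shows "empirical N \<xi> = distr (point_measure S (\<lambda>j. ennreal (c j))) borel (\<lambda>j. \<xi> (f j))"
proof (rule measure_eqI)
  show "sets (empirical N \<xi>) = sets (distr (point_measure S (\<lambda>j. ennreal (c j))) borel (\<lambda>j. \<xi> (f j)))"
    by simp
next
  fix A assume "A \<in> sets (empirical N \<xi>)"
  then have A: "A \<in> sets borel" by simp
  have "emeasure (distr (point_measure S (\<lambda>j. ennreal (c j))) borel (\<lambda>j. \<xi> (f j))) A
      = (\<Sum>j \<in> (\<lambda>j. \<xi> (f j)) -` A \<inter> S. ennreal (c j))"
    using A S by (simp add: emeasure_distr space_point_measure emeasure_point_measure_finite)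
  also have "\<dots> = (\<Sum>j\<in>S. ennreal (c j) * indicator A (\<xi> (f j)))"
    by (rule sum.mono_neutral_cong_left) (use S in \<open>auto simp: indicator_def\<close>)
  also have "\<dots> = (\<Sum>i=1..N. \<Sum>j | j \<in> S \<and> f j = i. ennreal (c j) * indicator A (\<xi> (f j)))"
    by (rule sum.group[symmetric]) (use S f in auto)
  also have "\<dots> = (\<Sum>i=1..N. ennreal (1 / real N) * indicator A (\<xi> i))"
  proof (rule sum.cong[OF refl])
    fix i assume i: "i \<in> {1..N}"
    have "(\<Sum>j | j \<in> S \<and> f j = i. ennreal (c j) * indicator A (\<xi> (f j)))
        = (\<Sum>j | j \<in> S \<and> f j = i. ennreal (c j)) * indicator A (\<xi> i)"
      unfolding sum_distrib_right by (rule sum.cong) auto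
    also have "(\<Sum>j | j \<in> S \<and> f j = i. ennreal (c j)) = ennreal (1 / real N)"
      using fibre[OF i] c by (subst sum_ennreal) auto
    finally show "(\<Sum>j | j \<in> S \<and> f j = i. ennreal (c j) * indicator A (\<xi> (f j)))
        = ennreal (1 / real N) * indicator A (\<xi> i)" .
  qed
  also have "\<dots> = emeasure (empirical N \<xi>) A"
    using A by (simp add: emeasure_empirical sum_distrib_left)
  finally show "emeasure (empirical N \<xi>) A =
      emeasure (distr (point_measure S (\<lambda>j. ennreal (c j))) borel (\<lambda>j. \<xi> (f j))) A" by simp
qed

lemma nn_integral_empirical:
  assumes [measurable]: "f \<in> borel_measurable borel" and nn: "\<And>z. 0 \<le> f z"
  shows "(\<integral>\<^sup>+ z. ennreal (f z) \<partial>empirical N \<xi>) = ennreal (1 / real N * (\<Sum>i=1..N. f (\<xi> i)))"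
proof -
  have fib: "{j. (1 \<le> j \<and> j \<le> N) \<and> j = i} = {i}" if "i \<in> {1..N}" for i
    using that by auto
  have "empirical N \<xi> = distr (point_measure {1..N} (\<lambda>_. ennreal (1 / real N))) borel (\<lambda>i. \<xi> i)"
    by (rule empirical_eq_distr_point_measure) (use fib in auto)
  then have "(\<integral>\<^sup>+ z. ennreal (f z) \<partial>empirical N \<xi>)
      = (\<integral>\<^sup>+ i. ennreal (f (\<xi> i)) \<partial>point_measure {1..N} (\<lambda>_. ennreal (1 / real N)))"
    by (simp add: nn_integral_distr)
  also have "\<dots> = ennreal (1 / real N * (\<Sum>i=1..N. f (\<xi> i)))"
    using nn by (simp add: nn_integral_point_measure_finite sum_distrib_left
        flip: sum_ennreal ennreal_mult)
  finally show ?thesis .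
qed

section \<open>The worst-case tail risk of an affine function\<close>

lemma worst_case_expectation_le:
  fixes a :: "'a :: euclidean_space"
  assumes P: "P \<in> ambiguity_set 1 r N \<xi>" and r: "0 \<le> r"
  shows "(\<integral>z. max (a \<bullet> z + b) 0 \<partial>P) \<le> r * norm a + 1 / real N * (\<Sum>i=1..N. max (a \<bullet> \<xi> i + b) 0)"
proof -
  let ?\<phi> = "\<lambda>z. max (a \<bullet> z + b) 0"
  have lip: "(norm a)-lipschitz_on UNIV ?\<phi>"
  proof (rule lipschitz_onI)
    fix z z' :: 'a
    have "\<bar>a \<bullet> z - a \<bullet> z'\<bar> \<le> norm a * dist z z'"
      using Cauchy_Schwarz_ineq2[of a "z - z'"] by (simp add: inner_diff_right dist_norm)
    then show "dist (?\<phi> z) (?\<phi> z') \<le> norm a * dist z z'" by (auto simp: dist_real_def)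
  qed simp
  have sets: "sets P = sets borel" and "transport_cost 1 P (empirical N \<xi>) \<le> ennreal r"
    using P r by (auto simp: ambiguity_set_def wass_space_def wasserstein_1_le_iff)
  then have "(\<integral>\<^sup>+z. ?\<phi> z \<partial>P) \<le> (\<integral>\<^sup>+z. ?\<phi> z \<partial>empirical N \<xi>) + ennreal (norm a * r)"
    by (intro lipschitz_transport_bound[OF lip]) (auto simp: r)
  also have "\<dots> = ennreal (r * norm a + 1 / real N * (\<Sum>i=1..N. ?\<phi> (\<xi> i)))"
    using r by (subst nn_integral_empirical) (auto simp: sum_nonneg mult.commute add.commute
        simp flip: ennreal_plus)
  finally have "enn2real (\<integral>\<^sup>+z. ?\<phi> z \<partial>P) \<le> r * norm a + 1 / real N * (\<Sum>i=1..N. ?\<phi> (\<xi> i))"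
    using r by (intro enn2real_leI) (auto intro!: add_nonneg_nonneg mult_nonneg_nonneg sum_nonneg
        simp del: times_divide_eq_left)
  moreover have "?\<phi> \<in> borel_measurable P"
    using sets by (simp cong: measurable_cong_sets)
  ultimately show ?thesis by (simp add: integral_eq_nn_integral)
qed

text \<open>
  The worst distribution: the part \<open>w i\<close> of the atom at \<open>\<xi> i\<close> is displaced by
  \<open>(r / \<epsilon>) *\<^sub>R sgn a\<close> and the remainder stays.  The bound holds for every \<open>t\<close> because
  a positive part is at least its argument on the displaced mass and at least zero elsewhere.
  As \<open>sgn 0 = 0\<close>, nothing moves when \<open>a = 0\<close>; otherwise the cost is \<open>\<epsilon> * (r / \<epsilon>) = r\<close>.
\<close>

lemma shifted_tail_distribution:
  fixes \<xi> :: "nat \<Rightarrow> 'a :: euclidean_space"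
  assumes N: "N \<ge> 1" and r: "0 \<le> r" and \<epsilon>: "0 < \<epsilon>"
    and w: "\<And>i. i \<in> {1..N} \<Longrightarrow> 0 \<le> w i" "\<And>i. i \<in> {1..N} \<Longrightarrow> w i \<le> 1 / real N"
      "(\<Sum>i=1..N. w i) = \<epsilon>"
  obtains P where "P \<in> ambiguity_set 1 r N \<xi>"
    "\<And>t. r * norm a + (\<Sum>i=1..N. w i * (a \<bullet> \<xi> i + b)) + t * \<epsilon> \<le> (\<integral>z. max (a \<bullet> z + b + t) 0 \<partial>P)"
proof -
  let ?v = "(r / \<epsilon>) *\<^sub>R sgn a"
  let ?S = "{1..N} \<times> (UNIV :: bool set)"
  define c where "c = (\<lambda>(i, moved). if moved then w i else 1 / real N - w i)"
  define pos where "pos = (\<lambda>(i, moved). if moved then \<xi> i + ?v else \<xi> i)"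
  define P where "P = distr (point_measure ?S (\<lambda>j. ennreal (c j))) borel pos"
  have c: "0 \<le> c j" if "j \<in> ?S" for j
    using w that by (auto simp: c_def)
  have split: "(\<Sum>j\<in>?S. g j) = (\<Sum>i=1..N. g (i, True) + g (i, False))" for g :: "_ \<Rightarrow> real"
    using sum.cartesian_product'[of g "{1..N}" UNIV] by (simp add: UNIV_bool add.commute)
  have "(\<Sum>j | j \<in> ?S \<and> fst j = i. c j) = 1 / real N" if "i \<in> {1..N}" for i
  proof -
    have "{j. j \<in> ?S \<and> fst j = i} = {(i, True), (i, False)}" using that by auto
    then show ?thesis by (simp add: c_def)
  qed
  then have emp: "empirical N \<xi> = distr (point_measure ?S (\<lambda>j. ennreal (c j))) borel (\<lambda>j. \<xi> (fst j))"
    by (intro empirical_eq_distr_point_measure c) auto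
  have "(\<Sum>j\<in>?S. c j * dist (pos j) (\<xi> (fst j))) = (\<Sum>i=1..N. w i) * norm ?v"
    unfolding split by (simp add: c_def pos_def dist_norm sum_distrib_right del: norm_scaleR)
  also have "\<dots> \<le> r" using w(3) \<epsilon> r by (simp add: norm_sgn)
  finally have "ennreal (\<Sum>j\<in>?S. c j * dist (pos j) (\<xi> (fst j))) \<le> ennreal r"
    by (rule ennreal_leI)
  moreover have "transport_cost 1 P (empirical N \<xi>)
      \<le> ennreal (\<Sum>j\<in>?S. c j * dist (pos j) (\<xi> (fst j)))"
    unfolding P_def emp by (rule transport_cost_point_measure) (use c in auto)
  ultimately have "transport_cost 1 P (empirical N \<xi>) \<le> ennreal r"
    by (rule order.trans[rotated])
  moreover have "sum c ?S = 1"
    unfolding split using N by (simp add: c_def)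
  then have "P \<in> wass_space 1"
    unfolding P_def by (intro point_measure_in_wass_space c) simp
  ultimately have mem: "P \<in> ambiguity_set 1 r N \<xi>"
    using r by (simp add: ambiguity_set_def wasserstein_1_le_iff)
  have "r * norm a + (\<Sum>i=1..N. w i * (a \<bullet> \<xi> i + b)) + t * \<epsilon> \<le> (\<integral>z. max (a \<bullet> z + b + t) 0 \<partial>P)" for t
  proof -
    have "a \<bullet> sgn a = norm a"
      by (cases "a = 0") (simp_all add: sgn_div_norm dot_square_norm power2_eq_square)
    then have v: "a \<bullet> ?v = r * norm a / \<epsilon>" by simp
    have "r * norm a + (\<Sum>i=1..N. w i * (a \<bullet> \<xi> i + b)) + t * \<epsilon>
        = (\<Sum>i=1..N. w i * (a \<bullet> \<xi> i + b)) + (r * norm a / \<epsilon> + t) * (\<Sum>i=1..N. w i)"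
      unfolding w(3) using \<epsilon> by (simp add: field_simps)
    also have "\<dots> = (\<Sum>i=1..N. w i * (a \<bullet> (\<xi> i + ?v) + b + t))"
      unfolding sum_distrib_left sum.distrib[symmetric] inner_add_right v
      by (intro sum.cong) (auto simp: algebra_simps)
    also have "\<dots> \<le> (\<Sum>j\<in>?S. c j * max (a \<bullet> pos j + b + t) 0)"
      unfolding split
    proof (rule sum_mono)
      fix i assume "i \<in> {1..N}"
      then have wi: "0 \<le> w i" "0 \<le> 1 / real N - w i" using w by auto
      have "w i * (a \<bullet> (\<xi> i + ?v) + b + t) \<le> w i * max (a \<bullet> (\<xi> i + ?v) + b + t) 0"
        by (rule mult_left_mono[OF max.cobounded1 wi(1)])
      moreover have "0 \<le> (1 / real N - w i) * max (a \<bullet> \<xi> i + b + t) 0"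
        by (rule mult_nonneg_nonneg[OF wi(2) max.cobounded2])
      ultimately show "w i * (a \<bullet> (\<xi> i + ?v) + b + t) \<le> c (i, True) * max (a \<bullet> pos (i, True) + b + t) 0
          + c (i, False) * max (a \<bullet> pos (i, False) + b + t) 0"
        unfolding c_def pos_def prod.case if_True if_False
        by linarith
    qed
    also have "\<dots> = (\<integral>z. max (a \<bullet> z + b + t) 0 \<partial>P)"
    proof -
      have "pos \<in> point_measure ?S (\<lambda>j. ennreal (c j)) \<rightarrow>\<^sub>M borel" by simp
      then have "(\<integral>z. max (a \<bullet> z + b + t) 0 \<partial>P)
          = (\<integral>j. max (a \<bullet> pos j + b + t) 0 \<partial>point_measure ?S (\<lambda>j. ennreal (c j)))"
        unfolding P_def by (rule integral_distr) measurable
      also have "\<dots> = (\<Sum>j\<in>?S. c j *\<^sub>R max (a \<bullet> pos j + b + t) 0)"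
        by (rule lebesgue_integral_point_measure_finite) (use c in auto)
      finally show ?thesis by simp
    qed
    finally show ?thesis .
  qed
  with mem show ?thesis by (rule that)
qed

lemma worst_case_cvar_le_0_iff:
  fixes a :: "'a :: euclidean_space"
  assumes N: "N \<ge> 1" and \<epsilon>: "0 < \<epsilon>" "\<epsilon> \<le> 1" and r: "0 \<le> r"
  shows "(SUP P \<in> ambiguity_set 1 r N \<xi>. INF t :: real.
      ereal (inverse \<epsilon> * (\<integral>z. max (a \<bullet> z + b + t) 0 \<partial>P) - t)) \<le> 0 \<longleftrightarrow>
    (\<exists>t. r * norm a + 1 / real N * (\<Sum>i=1..N. max (a \<bullet> \<xi> i + b + t) 0) - t * \<epsilon> \<le> 0)"
    (is "?risk \<le> 0 \<longleftrightarrow> _")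
proof
  assume "\<exists>t. r * norm a + 1 / real N * (\<Sum>i=1..N. max (a \<bullet> \<xi> i + b + t) 0) - t * \<epsilon> \<le> 0"
  then obtain t where t: "r * norm a + 1 / real N * (\<Sum>i=1..N. max (a \<bullet> \<xi> i + b + t) 0) - t * \<epsilon> \<le> 0" ..
  show "?risk \<le> 0"
  proof (rule SUP_least)
    fix P assume "P \<in> ambiguity_set 1 r N \<xi>"
    then have "(\<integral>z. max (a \<bullet> z + (b + t)) 0 \<partial>P) \<le> t * \<epsilon>"
      using worst_case_expectation_le[of P r N \<xi> a "b + t"] r t by (simp add: add.assoc)
    then have "inverse \<epsilon> * (\<integral>z. max (a \<bullet> z + b + t) 0 \<partial>P) - t \<le> 0"
      using \<epsilon> by (simp add: field_simps add.assoc)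
    then show "(INF t :: real. ereal (inverse \<epsilon> * (\<integral>z. max (a \<bullet> z + b + t) 0 \<partial>P) - t)) \<le> 0"
      by (intro INF_lower2[of t]) auto
  qed
next
  assume risk: "?risk \<le> 0"
  obtain t w where w: "\<And>i. i \<in> {1..N} \<Longrightarrow> 0 \<le> w i" "\<And>i. i \<in> {1..N} \<Longrightarrow> w i \<le> 1 / real N"
      "(\<Sum>i=1..N. w i) = \<epsilon>"
    and t: "1 / real N * (\<Sum>i=1..N. max (a \<bullet> \<xi> i + b + t) 0) - t * \<epsilon> = (\<Sum>i=1..N. w i * (a \<bullet> \<xi> i + b))"
    by (rule cvar_eq_tail_mean[of N \<epsilon> "\<lambda>i. a \<bullet> \<xi> i + b"]) (use N \<epsilon> in auto)
  obtain P where P: "P \<in> ambiguity_set 1 r N \<xi>"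
    and E: "\<And>t. r * norm a + (\<Sum>i=1..N. w i * (a \<bullet> \<xi> i + b)) + t * \<epsilon> \<le> (\<integral>z. max (a \<bullet> z + b + t) 0 \<partial>P)"
    by (rule shifted_tail_distribution[of N r \<epsilon> w \<xi> a b]) (use N r \<epsilon> w in auto)
  let ?tail = "r * norm a + (\<Sum>i=1..N. w i * (a \<bullet> \<xi> i + b))"
  have "ereal (inverse \<epsilon> * ?tail) \<le> (INF t :: real. ereal (inverse \<epsilon> * (\<integral>z. max (a \<bullet> z + b + t) 0 \<partial>P) - t))"
  proof (rule INF_greatest)
    fix t :: real
    have "inverse \<epsilon> * ?tail + t = inverse \<epsilon> * (?tail + t * \<epsilon>)"
      using \<epsilon> by (simp add: field_simps)
    also have "\<dots> \<le> inverse \<epsilon> * (\<integral>z. max (a \<bullet> z + b + t) 0 \<partial>P)"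
      using \<epsilon> E by (intro mult_left_mono) auto
    finally show "ereal (inverse \<epsilon> * ?tail) \<le> ereal (inverse \<epsilon> * (\<integral>z. max (a \<bullet> z + b + t) 0 \<partial>P) - t)"
      by simp
  qed
  also have "\<dots> \<le> ?risk" using P by (rule SUP_upper)
  also note risk
  finally have "inverse \<epsilon> * ?tail \<le> 0" by simp
  then have "?tail \<le> 0" using \<epsilon> by (simp add: mult_le_0_iff)
  then show "\<exists>t. r * norm a + 1 / real N * (\<Sum>i=1..N. max (a \<bullet> \<xi> i + b + t) 0) - t * \<epsilon> \<le> 0"
    using t by (intro exI[of _ t]) linarith
qed

section \<open>Epigraph form\<close>

lemma square_le_iff_cone:
  fixes d :: "'a :: real_inner"
  shows "sqrt ((norm (2 *\<^sub>R d))\<^sup>2 + (y - 1)\<^sup>2) \<le> y + 1 \<longleftrightarrow> (norm d)\<^sup>2 \<le> y"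
proof -
  have eq: "(y + 1)\<^sup>2 - ((norm (2 *\<^sub>R d))\<^sup>2 + (y - 1)\<^sup>2) = 4 * (y - (norm d)\<^sup>2)"
    by (simp add: power_mult_distrib) (simp add: power2_eq_square algebra_simps)
  show ?thesis
  proof
    assume "sqrt ((norm (2 *\<^sub>R d))\<^sup>2 + (y - 1)\<^sup>2) \<le> y + 1"
    then show "(norm d)\<^sup>2 \<le> y" using sqrt_le_D eq by fastforce
  next
    assume y: "(norm d)\<^sup>2 \<le> y"
    then have "0 \<le> y + 1" by (smt (verit) zero_le_power2)
    then show "sqrt ((norm (2 *\<^sub>R d))\<^sup>2 + (y - 1)\<^sup>2) \<le> y + 1"
      using eq y by (intro real_le_lsqrt) auto
  qed
qed

text \<open>
  The objective of the lifted program does not depend on the witness \<open>v\<close>, so the best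
  completion of a feasible \<open>u\<close> takes \<open>y = f u\<close> with any witness.
\<close>

lemma equivalent_programs_epigraph:
  assumes F: "\<And>u. u \<in> F \<longleftrightarrow> (\<exists>v. S u v)"
  shows "equivalent_programs F f {(u, y, v). S u v \<and> f u \<le> y} (\<lambda>(u, y, v). y)"
    (is "equivalent_programs F f ?F' ?f'")
  unfolding equivalent_programs_def
proof (intro conjI allI)
  fix u
  show "u \<in> F \<longleftrightarrow> (\<exists>v. (u, v) \<in> ?F')"
    using F by auto
  show "is_optimal F f u \<longleftrightarrow> (\<exists>v. is_optimal ?F' ?f' (u, v))"
  proof
    assume opt: "is_optimal F f u"
    then obtain v where "S u v" using F by (auto simp: is_optimal_def)
    moreover have "f u \<le> y" if "S u' v'" "f u' \<le> y" for u' y v'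
    proof -
      have "u' \<in> F" using F that by blast
      then have "f u \<le> f u'" using opt by (simp add: is_optimal_def)
      with that show ?thesis by simp
    qed
    ultimately have "is_optimal ?F' ?f' (u, f u, v)"
      by (auto simp: is_optimal_def)
    then show "\<exists>v. is_optimal ?F' ?f' (u, v)" ..
  next
    assume "\<exists>v. is_optimal ?F' ?f' (u, v)"
    then obtain y v where opt: "is_optimal ?F' ?f' (u, y, v)" by auto
    then have S: "S u v" "f u \<le> y" by (auto simp: is_optimal_def)
    have min: "y \<le> y'" if "S u' v'" "f u' \<le> y'" for u' y' v'
      using opt that by (auto simp: is_optimal_def)
    have "u \<in> F" using F S by blast
    moreover have "f u \<le> f u'" if "u' \<in> F" for u'
      using F that S(2) min[of u' _ "f u'"] by force
    ultimately show "is_optimal F f u" by (simp add: is_optimal_def)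
  qed
next
  show "optimal_value F f = optimal_value ?F' ?f'"
    unfolding optimal_value_def
  proof (rule antisym)
    show "(INF z\<in>F. ereal (f z)) \<le> (INF z\<in>?F'. ereal (?f' z))"
    proof (rule INF_greatest)
      fix z assume "z \<in> ?F'"
      then have "fst z \<in> F" "f (fst z) \<le> ?f' z" using F by auto
      then show "(INF z\<in>F. ereal (f z)) \<le> ereal (?f' z)" by (intro INF_lower2) auto
    qed
    show "(INF z\<in>?F'. ereal (?f' z)) \<le> (INF z\<in>F. ereal (f z))"
    proof (rule INF_greatest)
      fix u assume "u \<in> F"
      then obtain v where "S u v" using F by auto
      then show "(INF z\<in>?F'. ereal (?f' z)) \<le> ereal (f u)"
        by (intro INF_lower2[of "(u, f u, v)"]) auto
    qed
  qed
qed

section \<open>Equivalence with the second-order cone program\<close>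

theorem mainTheorem1:
  fixes N M :: nat
    and X :: "(real ^ 'n) set" and x :: "real ^ 'n"
    and \<epsilon> r :: real
    and k :: "real ^ 'n \<Rightarrow> real ^ ('m :: finite option)"
    and q :: "nat \<Rightarrow> real ^ 'n \<Rightarrow> real ^ 'm option"
    and R :: "nat \<Rightarrow> real ^ 'n \<Rightarrow> real ^ 'k ^ 'm option"
    and J :: "nat \<Rightarrow> real ^ 'n \<Rightarrow> 'j"
    and \<alpha> :: "nat \<Rightarrow> 'j \<Rightarrow> real"
    and \<xi>s :: "nat \<Rightarrow> real ^ 'k"
    and G :: "nat \<Rightarrow> real ^ 'n \<Rightarrow> real ^ 'm option \<Rightarrow> real ^ 'k \<Rightarrow> real"
  assumes "N \<ge> 1" and "M \<ge> 1"
    and "0 < \<epsilon>" and "\<epsilon> < 1" and "r \<ge> 0"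
    and "\<And>x. x \<in> X \<Longrightarrow> k x \<in> aug_inputs"
    and "\<And>l x u \<xi>. G l x u \<xi> = u \<bullet> q l x + (u v* R l x) \<bullet> \<xi> + \<alpha> l (J l x)"
    and "x \<in> X"
  shows "equivalent_programs
    {u \<in> aug_inputs. \<forall>l\<in>{1..M}.
       (SUP P \<in> ambiguity_set 1 r N \<xi>s. INF t :: real.
          ereal (inverse \<epsilon> * (\<integral>\<xi>. max (G l x u \<xi> + t) 0 \<partial>P) - t)) \<le> 0}
    (\<lambda>u. (norm (u - k x))\<^sup>2)
    {(u, y :: real, t :: nat \<Rightarrow> real, s :: nat \<Rightarrow> nat \<Rightarrow> real). u \<in> aug_inputs \<and>
       (\<forall>l\<in>{1..M}. r * norm (u v* R l x) + 1 / real N * (\<Sum>i=1..N. s l i) - t l * \<epsilon> \<le> 0) \<and>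
       (\<forall>l\<in>{1..M}. \<forall>i\<in>{1..N}. s l i \<ge> G l x u (\<xi>s i) + t l \<and> s l i \<ge> 0) \<and>
       y + 1 \<ge> sqrt ((norm (2 *\<^sub>R (u - k x)))\<^sup>2 + (y - 1)\<^sup>2)}
    (\<lambda>(u, y, t, s). y)"
proof -
  define b where "b u l = u \<bullet> q l x + \<alpha> l (J l x)" for u l
  have G: "G l x u z + t = (u v* R l x) \<bullet> z + b u l + t" for l u z t
    by (simp add: assms(7) b_def)
  have risk: "(SUP P \<in> ambiguity_set 1 r N \<xi>s. INF t :: real.
        ereal (inverse \<epsilon> * (\<integral>\<xi>. max (G l x u \<xi> + t) 0 \<partial>P) - t)) \<le> 0 \<longleftrightarrow>
      (\<exists>t. r * norm (u v* R l x) + 1 / real N * (\<Sum>i=1..N. max (G l x u (\<xi>s i) + t) 0) - t * \<epsilon> \<le> 0)"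
    for l u
    unfolding G using assms by (intro worst_case_cvar_le_0_iff) auto
  let ?cone = "\<lambda>u (t, s). u \<in> aug_inputs \<and>
    (\<forall>l\<in>{1..M}. r * norm (u v* R l x) + 1 / real N * (\<Sum>i=1..N. s l i) - t l * \<epsilon> \<le> 0) \<and>
    (\<forall>l\<in>{1..M}. \<forall>i\<in>{1..N}. s l i \<ge> G l x u (\<xi>s i) + t l \<and> s l i \<ge> 0)"
  have "u \<in> {u \<in> aug_inputs. \<forall>l\<in>{1..M}.
       (SUP P \<in> ambiguity_set 1 r N \<xi>s. INF t :: real.
          ereal (inverse \<epsilon> * (\<integral>\<xi>. max (G l x u \<xi> + t) 0 \<partial>P) - t)) \<le> 0} \<longleftrightarrow>
      (\<exists>v. ?cone u v)" for u
    unfolding risk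
  proof safe
    assume u: "u \<in> aug_inputs" and "\<forall>l\<in>{1..M}. \<exists>t. r * norm (u v* R l x) +
      1 / real N * (\<Sum>i=1..N. max (G l x u (\<xi>s i) + t) 0) - t * \<epsilon> \<le> 0"
    then obtain t where t: "\<forall>l\<in>{1..M}. r * norm (u v* R l x) +
      1 / real N * (\<Sum>i=1..N. max (G l x u (\<xi>s i) + t l) 0) - t l * \<epsilon> \<le> 0"
      by metis
    with u show "\<exists>v. ?cone u v"
      by (intro exI[of _ "(t, \<lambda>l i. max (G l x u (\<xi>s i) + t l) 0)"]) auto
  next
    fix t s l
    assume cone: "\<forall>l\<in>{1..M}. r * norm (u v* R l x) + 1 / real N * (\<Sum>i=1..N. s l i) - t l * \<epsilon> \<le> 0"
      "\<forall>l\<in>{1..M}. \<forall>i\<in>{1..N}. s l i \<ge> G l x u (\<xi>s i) + t l \<and> s l i \<ge> 0" and l: "l \<in> {1..M}"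
    have "1 / real N * (\<Sum>i=1..N. max (G l x u (\<xi>s i) + t l) 0) \<le> 1 / real N * (\<Sum>i=1..N. s l i)"
      using cone(2) l by (intro mult_left_mono sum_mono) auto
    moreover have "r * norm (u v* R l x) + 1 / real N * (\<Sum>i=1..N. s l i) - t l * \<epsilon> \<le> 0"
      using cone(1) l by blast
    ultimately show "\<exists>t. r * norm (u v* R l x) +
      1 / real N * (\<Sum>i=1..N. max (G l x u (\<xi>s i) + t) 0) - t * \<epsilon> \<le> 0"
      by (intro exI[of _ "t l"]) linarith
  qed
  from equivalent_programs_epigraph[OF this, of "\<lambda>u. (norm (u - k x))\<^sup>2"]
  show ?thesis
    unfolding square_le_iff_cone by (simp add: case_prod_unfold conj_assoc)
qed

end
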